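(* There exists a constant $c>0$ such that for every integer $n\geq 1$, $L_2(n)\leq 2^{cn^8(\log n)^2}$; that is, every $N\times N$ real matrix with $N\geq 2^{cn^8(\log n)^2}$ contains an $n\times n$ lex-monotone submatrix.
   Context: A 2-dimensional array is a function $A:S_1\times S_2\to\mathbb{R}$ with $S_1,S_2$ finite sets of integers; an $n\times n$ subarray is the restriction of $A$ to $S_1'\times S_2'$ with $S_i'\subset S_i$, $|S_i'|=n$ (an $N\times N$ matrix is such an array with $S_1=S_2=[N]$). The array $A$ is lex-monotone if there exist a permutation $\sigma$ of $\{1,2\}$ and signs $s\in\{-1,1\}^2$ such that for all $(a_1,a_2),(b_1,b_2)\in S_1\times S_2$: $A(a_1,a_2)<A(b_1,b_2)$ if and only if $(s(\sigma(1))a_{\sigma(1)},\,s(\sigma(2))a_{\sigma(2)})<_{LEX}(s(\sigma(1))b_{\sigma(1)},\,s(\sigma(2))b_{\sigma(2)})$, where $(x_1,x_2)<_{LEX}(y_1,y_2)$ means $x_b<y_b$ for the smallest index $b$ with $x_b\neq y_b$. $L_2(n)$ is the smallest $N$ such that every $N\times N$ real array contains an $n\times n$ lex-monotone subarray.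
   Formalization: Arrays are required to have pairwise distinct entries, also in the definition of L_2(n); without this the claim fails for n ≥ 2, since a constant array has no 2×2 lex-monotone subarray. *)

theory Defs
  imports Complex_Main "HOL-Combinatorics.Permutations"
begin

definition coord :: "nat \<Rightarrow> int \<times> int \<Rightarrow> int" where
  "coord i p = (if i = 1 then fst p else snd p)"

definition lex_less :: "(int \<times> int) \<Rightarrow> (int \<times> int) \<Rightarrow> bool" where
  "lex_less x y \<longleftrightarrow> (x, y) \<in> {(u, v). u < v} <*lex*> {(u, v). u < v}"

(* The entries are required to be pairwise distinct. A lex-monotone array necessarily has distinct
   entries (two distinct positions are always lex-comparable), so without this requirement a
   constant array would have no 2 x 2 lex-monotone subarray and L2 n would not exist for n >= 2. *)
definition is_array :: "nat \<Rightarrow> int set \<Rightarrow> int set \<Rightarrow> (int \<times> int \<Rightarrow> real) \<Rightarrow> bool" where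
  "is_array N S1 S2 A \<longleftrightarrow>
     finite S1 \<and> finite S2 \<and> card S1 = N \<and> card S2 = N \<and> inj_on A (S1 \<times> S2)"

definition lex_monotone :: "int set \<Rightarrow> int set \<Rightarrow> (int \<times> int \<Rightarrow> real) \<Rightarrow> bool" where
  "lex_monotone S1 S2 A \<longleftrightarrow>
     (\<exists>\<sigma> s. \<sigma> permutes {1, 2::nat} \<and> (\<forall>i\<in>{1, 2::nat}. s i \<in> {-1, 1::int}) \<and>
        (\<forall>a\<in>S1 \<times> S2. \<forall>b\<in>S1 \<times> S2.
           A a < A b \<longleftrightarrow>
           lex_less (s (\<sigma> 1) * coord (\<sigma> 1) a, s (\<sigma> 2) * coord (\<sigma> 2) a)
                    (s (\<sigma> 1) * coord (\<sigma> 1) b, s (\<sigma> 2) * coord (\<sigma> 2) b)))"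

definition contains_lex_monotone ::
    "nat \<Rightarrow> int set \<Rightarrow> int set \<Rightarrow> (int \<times> int \<Rightarrow> real) \<Rightarrow> bool" where
  "contains_lex_monotone n S1 S2 A \<longleftrightarrow>
     (\<exists>T1 T2. T1 \<subseteq> S1 \<and> T2 \<subseteq> S2 \<and> finite T1 \<and> finite T2 \<and> card T1 = n \<and> card T2 = n \<and>
        lex_monotone T1 T2 A)"

definition L2 :: "nat \<Rightarrow> nat" where
  "L2 n = (LEAST N. \<forall>S1 S2 A. is_array N S1 S2 A \<longrightarrow> contains_lex_monotone n S1 S2 A)"

end

theory Submission imports Defs begin

text \<open>
  By the Erdos-Szekeres theorem and the pigeonhole principle, there are \<open>m = n N\<close> rows with
  \<open>N = O(n^3)\<close> and exponentially many columns that are all monotone, in the same direction, on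
  these rows. Cut the rows into \<open>N\<close> blocks of \<open>n\<close>. Halving repeatedly, any large set of columns
  contains two large subsets \<open>X < Y\<close> such that for every block the comparisons between \<open>X\<close> and \<open>Y\<close>
  of its first and last rows have constant outcome: either \<open>X\<close> lies entirely below or above \<open>Y\<close> on
  the block, or the two interleave and the first row is increasing or decreasing from \<open>X\<close> to \<open>Y\<close>.
  Iterating gives a binary tree of columns whose splits are labelled by these outcomes; a counting
  argument makes all labels on a level equal, at the cost of a depth quadratic in the number of
  levels kept. Keep \<open>8 k\<close> levels with \<open>n \<le> 2 ^ k\<close>. If some block is entirely below, or entirely
  above, on \<open>k\<close> levels, the leaves of the subtree spanned by these levels give a column-major
  subarray. Otherwise every block interleaves with one and the same direction on at least \<open>3 k\<close>
  levels, so \<open>n\<close> blocks share \<open>k\<close> such levels, and their first rows give a row-major subarray.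
\<close>

section \<open>Separating two finite sets by comparisons\<close>

lemma finite_lower_part:
  fixes f :: "'a \<Rightarrow> 'b::linorder"
  assumes "finite X" "q \<le> card X"
  shows "\<exists>Y\<subseteq>X. card Y = q \<and> (\<forall>x\<in>Y. \<forall>y\<in>X - Y. f x \<le> f y)"
  using assms(2)
proof (induction q)
  case 0
  then show ?case by (intro exI[of _ "{}"]) auto
next
  case (Suc q)
  then obtain Y where Y: "Y \<subseteq> X" "card Y = q" "\<forall>x\<in>Y. \<forall>y\<in>X - Y. f x \<le> f y" by auto
  have fin: "finite Y" using Y assms finite_subset by blast
  have ne: "X - Y \<noteq> {}" using Suc.prems Y card_mono[OF fin] by fastforce
  obtain z where z: "z \<in> X - Y" "\<And>y. y \<in> X - Y \<Longrightarrow> f z \<le> f y"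
    using arg_min_if_finite[of "X - Y" f] ne assms(1)
    by (metis finite_Diff linorder_not_le)
  show ?case
    using Y z fin by (intro exI[of _ "insert z Y"]) auto
qed

text \<open>Cut \<open>X\<close> by \<open>f\<close> and \<open>Y\<close> by \<open>g\<close> into a
  lower and an upper part. If the lower part \<open>P\<close> of \<open>X\<close> is not below the
  upper part of \<open>Y\<close>, one failing pair \<open>x\<close>, \<open>y\<close> links the
  other two parts: on \<open>Q\<close> the values of \<open>g\<close> are at most
  \<open>g y \<le> f x\<close>, and on \<open>X - P\<close> those of \<open>f\<close> are at least
  \<open>f x\<close>. Excluding equality makes this strict.\<close>

lemma separate_halves:
  fixes f :: "'a \<Rightarrow> 'c::linorder" and g :: "'b \<Rightarrow> 'c"
  assumes "finite X" "finite Y" "2 * q \<le> card X" "2 * q \<le> card Y"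
    and neq: "\<And>x y. x \<in> X \<Longrightarrow> y \<in> Y \<Longrightarrow> f x \<noteq> g y"
  shows "\<exists>X'\<subseteq>X. \<exists>Y'\<subseteq>Y. q \<le> card X' \<and> q \<le> card Y' \<and>
    ((\<forall>x\<in>X'. \<forall>y\<in>Y'. f x < g y) \<or> (\<forall>x\<in>X'. \<forall>y\<in>Y'. g y < f x))"
proof -
  obtain P where P: "P \<subseteq> X" "card P = q" "\<forall>x\<in>P. \<forall>y\<in>X - P. f x \<le> f y"
    using finite_lower_part[of X q f] assms by auto
  obtain Q where Q: "Q \<subseteq> Y" "card Q = q" "\<forall>x\<in>Q. \<forall>y\<in>Y - Q. g x \<le> g y"
    using finite_lower_part[of Y q g] assms by auto
  have fin: "finite P" "finite Q" using P Q assms finite_subset by blast+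
  have c: "q \<le> card (X - P)" "q \<le> card (Y - Q)"
    using P Q assms fin by (simp_all add: card_Diff_subset)
  show ?thesis
  proof (cases "\<forall>x\<in>P. \<forall>y\<in>Y - Q. f x < g y")
    case True
    then show ?thesis using P Q c by (intro exI[of _ P] exI[of _ "Y - Q"]) auto
  next
    case False
    then obtain x y where xy: "x \<in> P" "y \<in> Y - Q" "g y \<le> f x" by (auto simp: not_less)
    have "g v < f u" if "u \<in> X - P" "v \<in> Q" for u v
    proof -
      have "g v \<le> g y" "f x \<le> f u" using P Q xy that by auto
      then have "g v \<le> f u" using xy by order
      then show ?thesis using neq[of u v] that Q by force
    qed
    then show ?thesis using P Q c by (intro exI[of _ "X - P"] exI[of _ Q]) auto
  qed
qed

text \<open>One application of \<open>separate_halves\<close> per test halves both sets, which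
  accounts for the factor \<open>2 ^ card T\<close>. Outcomes already fixed persist in subsets;
  \<open>w\<close> records the tests on which \<open>f\<close> falls below \<open>g\<close>.\<close>

lemma separate_all:
  fixes f g :: "'t \<Rightarrow> 'a \<Rightarrow> 'c::linorder"
  assumes "finite T" "finite X" "finite Y" "2 ^ card T * q \<le> card X" "2 ^ card T * q \<le> card Y"
    and "\<And>t x y. t \<in> T \<Longrightarrow> x \<in> X \<Longrightarrow> y \<in> Y \<Longrightarrow> f t x \<noteq> g t y"
  shows "\<exists>w\<subseteq>T. \<exists>X'\<subseteq>X. \<exists>Y'\<subseteq>Y. q \<le> card X' \<and> q \<le> card Y' \<and>
    (\<forall>t\<in>T. \<forall>x\<in>X'. \<forall>y\<in>Y'. if t \<in> w then f t x < g t y else g t y < f t x)"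
  using assms
proof (induction T arbitrary: X Y rule: finite_induct)
  case empty
  then show ?case by auto
next
  case (insert t T)
  have "2 * (2 ^ card T * q) \<le> card X" "2 * (2 ^ card T * q) \<le> card Y"
    using insert.prems insert.hyps by (simp_all add: mult.assoc)
  from separate_halves[OF insert.prems(1,2) this, of "f t" "g t"] insert.prems(5)
  obtain X1 Y1 where 1: "X1 \<subseteq> X" "Y1 \<subseteq> Y" "2 ^ card T * q \<le> card X1" "2 ^ card T * q \<le> card Y1"
    and d: "(\<forall>x\<in>X1. \<forall>y\<in>Y1. f t x < g t y) \<or> (\<forall>x\<in>X1. \<forall>y\<in>Y1. g t y < f t x)"
    by (metis insertI1)
  have fin: "finite X1" "finite Y1" using 1 insert.prems finite_subset by blast+
  have neq: "f u x \<noteq> g u y" if "u \<in> T" "x \<in> X1" "y \<in> Y1" for u x y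
    using insert.prems(5)[of u x y] that 1 by auto
  obtain w X' Y' where w: "w \<subseteq> T" "X' \<subseteq> X1" "Y' \<subseteq> Y1" "q \<le> card X'" "q \<le> card Y'"
    "\<And>u x y. u \<in> T \<Longrightarrow> x \<in> X' \<Longrightarrow> y \<in> Y' \<Longrightarrow> if u \<in> w then f u x < g u y else g u y < f u x"
    using insert.IH[OF fin 1(3,4) neq] by blast
  from d show ?case
  proof
    assume a: "\<forall>x\<in>X1. \<forall>y\<in>Y1. f t x < g t y"
    have "\<forall>u\<in>insert t T. \<forall>x\<in>X'. \<forall>y\<in>Y'. if u \<in> insert t w then f u x < g u y else g u y < f u x"
      using a w insert.hyps by auto (metis subsetD)+
    then show ?thesis using w 1
      by (intro exI[of _ "insert t w"] exI[of _ X'] exI[of _ Y'] conjI) auto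
  next
    assume a: "\<forall>x\<in>X1. \<forall>y\<in>Y1. g t y < f t x"
    have "t \<notin> w" using w insert.hyps by auto
    then have "\<forall>u\<in>insert t T. \<forall>x\<in>X'. \<forall>y\<in>Y'. if u \<in> w then f u x < g u y else g u y < f u x"
      using a w by auto (metis subsetD)+
    then show ?thesis using w 1
      by (intro exI[of _ w] exI[of _ X'] exI[of _ Y'] conjI) auto
  qed
qed

section \<open>Binary trees with one label per level\<close>

text \<open>A complete binary tree of subsets with a single label per level, obeyed by every pair of
  subtrees that split at that level.\<close>

fun has_tree :: "('w \<Rightarrow> 'a \<Rightarrow> 'a \<Rightarrow> bool) \<Rightarrow> 'w list \<Rightarrow> 'a set \<Rightarrow> bool" where
  "has_tree R [] X \<longleftrightarrow> X \<noteq> {}"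
| "has_tree R (w # ws) X \<longleftrightarrow>
    (\<exists>Y\<subseteq>X. \<exists>Z\<subseteq>X. (\<forall>y\<in>Y. \<forall>z\<in>Z. R w y z) \<and> has_tree R ws Y \<and> has_tree R ws Z)"

lemma has_tree_mono: "has_tree R ws X \<Longrightarrow> X \<subseteq> Y \<Longrightarrow> has_tree R ws Y"
  by (cases ws) (simp, blast, simp, metis order_trans)

text \<open>A level outside \<open>P\<close> is dropped by keeping only one of its two subtrees. As
  labels depend on the level alone, both subtrees carry the same remaining labels.\<close>

lemma has_tree_nths: "has_tree R ws X \<Longrightarrow> has_tree R (nths ws P) X"
proof (induction ws arbitrary: X P)
  case (Cons w ws)
  then obtain Y Z where YZ: "Y \<subseteq> X" "Z \<subseteq> X" "\<forall>y\<in>Y. \<forall>z\<in>Z. R w y z"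
    "has_tree R ws Y" "has_tree R ws Z" by auto
  then have "has_tree R (nths ws {j. Suc j \<in> P}) Y" "has_tree R (nths ws {j. Suc j \<in> P}) Z"
    using Cons.IH by auto
  with YZ(1-3) has_tree_mono[OF this(1) YZ(1)] show ?case
    unfolding nths_Cons by (cases "0 \<in> P") auto
qed auto

text \<open>One point is taken from every leaf; two of them are related by the label of the level
  where their branches part. Irreflexivity makes the two sides of a split disjoint, so the points
  are distinct.\<close>

lemma has_tree_leaves:
  assumes "has_tree R ws X" "\<And>w x. \<not> R w x x"
  shows "\<exists>S\<subseteq>X. finite S \<and> card S = 2 ^ length ws \<and>
    (\<forall>x\<in>S. \<forall>y\<in>S. x \<noteq> y \<longrightarrow> (\<exists>w\<in>set ws. R w x y \<or> R w y x))"
  using assms(1)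
proof (induction ws arbitrary: X)
  case Nil
  then obtain x where "x \<in> X" by auto
  then show ?case by (intro exI[of _ "{x}"]) auto
next
  case (Cons w ws)
  then obtain Y Z where YZ: "Y \<subseteq> X" "Z \<subseteq> X" "\<forall>y\<in>Y. \<forall>z\<in>Z. R w y z"
    "has_tree R ws Y" "has_tree R ws Z" by auto
  obtain S where S: "S \<subseteq> Y" "finite S" "card S = 2 ^ length ws"
    "\<forall>x\<in>S. \<forall>y\<in>S. x \<noteq> y \<longrightarrow> (\<exists>w\<in>set ws. R w x y \<or> R w y x)"
    using Cons.IH[OF YZ(4)] by auto
  obtain S' where S': "S' \<subseteq> Z" "finite S'" "card S' = 2 ^ length ws"
    "\<forall>x\<in>S'. \<forall>y\<in>S'. x \<noteq> y \<longrightarrow> (\<exists>w\<in>set ws. R w x y \<or> R w y x)"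
    using Cons.IH[OF YZ(5)] by auto
  have "S \<inter> S' = {}"
  proof (rule ccontr)
    assume "S \<inter> S' \<noteq> {}"
    then obtain x where "x \<in> S" "x \<in> S'" by auto
    then have "R w x x" using YZ(3) S(1) S'(1) by (simp add: subset_iff)
    then show False using assms(2) by simp
  qed
  then have "card (S \<union> S') = 2 ^ length (w # ws)" using S S' by (simp add: card_Un_disjoint)
  moreover have "\<forall>x\<in>S \<union> S'. \<forall>y\<in>S \<union> S'. x \<noteq> y \<longrightarrow> (\<exists>w\<in>set (w # ws). R w x y \<or> R w y x)"
    using YZ(3) S(1,4) S'(1,4) by (simp add: subset_iff) blast
  ultimately show ?case using S S' YZ
    by (intro exI[of _ "S \<union> S'"]) auto
qed

text \<open>Pigeonhole over label sequences: there are at most \<open>2 ^ (t * j)\<close> of length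
  \<open>j\<close>, so a set large enough for \<open>t * j + 1\<close> nested splits contains a
  split whose two sides realize a common one.\<close>

lemma exists_tree:
  fixes R :: "'w \<Rightarrow> 'a \<Rightarrow> 'a \<Rightarrow> bool"
  assumes W: "finite W" "card W \<le> 2 ^ t"
    and split: "\<And>X s. finite X \<Longrightarrow> 2 ^ Suc t * s \<le> card X \<Longrightarrow> X \<subseteq> U \<Longrightarrow>
      \<exists>w\<in>W. \<exists>Y\<subseteq>X. \<exists>Z\<subseteq>X. s \<le> card Y \<and> s \<le> card Z \<and> (\<forall>y\<in>Y. \<forall>z\<in>Z. R w y z)"
    and "finite X" "X \<subseteq> U" "2 ^ ((Suc t * j)\<^sup>2) \<le> card X"
  shows "\<exists>ws. length ws = j \<and> set ws \<subseteq> W \<and> has_tree R ws X"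
  using assms(4-)
proof (induction j arbitrary: X)
  case 0
  then show ?case by (intro exI[of _ "[]"]) auto
next
  case (Suc j)
  define D where "D = (2::nat) ^ ((Suc t * j)\<^sup>2)"
  define realizable where "realizable = (\<lambda>X. {ws. set ws \<subseteq> W \<and> length ws = j \<and> has_tree R ws X})"
  have finR: "finite (realizable X)" for X
    by (rule finite_subset[OF _ finite_lists_length_eq[OF W(1), of j]]) (auto simp: realizable_def)
  have cardR: "card (realizable X) \<le> 2 ^ (t * j)" for X
  proof -
    have "card (realizable X) \<le> card {ws. set ws \<subseteq> W \<and> length ws = j}"
      by (rule card_mono[OF finite_lists_length_eq[OF W(1)]]) (auto simp: realizable_def)
    also have "\<dots> = card W ^ j" using W(1) by (rule card_lists_length_eq)
    also have "\<dots> \<le> (2 ^ t) ^ j" using W(2) by (rule power_mono) simp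
    finally show ?thesis by (simp add: power_mult)
  qed
  \<comment> \<open>A label sequence realizable on both sides of a split extends by the label of the split. If
    this never happens, the number of realizable sequences doubles at every split.\<close>
  have growth: "2 ^ e \<le> card (realizable Y)"
    if "finite Y" "Y \<subseteq> U" "(2 ^ Suc t) ^ e * D \<le> card Y"
      "\<nexists>ws. length ws = Suc j \<and> set ws \<subseteq> W \<and> has_tree R ws Y" for e Y
    using that
  proof (induction e arbitrary: Y)
    case 0
    then have "\<exists>ws. length ws = j \<and> set ws \<subseteq> W \<and> has_tree R ws Y"
      using Suc.IH[of Y] by (simp add: D_def)
    then have "realizable Y \<noteq> {}" by (auto simp: realizable_def)
    then show ?case using finR[of Y] by (simp add: Suc_le_eq card_gt_0_iff)
  next
    case (Suc e)
    have "2 ^ Suc t * ((2 ^ Suc t) ^ e * D) \<le> card Y"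
      using Suc.prems(3) by (simp add: mult.assoc)
    from split[OF Suc.prems(1) this Suc.prems(2)] obtain w P Q where
      w: "w \<in> W" "P \<subseteq> Y" "Q \<subseteq> Y" "(2 ^ Suc t) ^ e * D \<le> card P" "(2 ^ Suc t) ^ e * D \<le> card Q"
      "\<forall>y\<in>P. \<forall>z\<in>Q. R w y z" by blast
    have sub: "realizable P \<subseteq> realizable Y" "realizable Q \<subseteq> realizable Y"
      using w has_tree_mono by (auto simp: realizable_def)
    have disj: "realizable P \<inter> realizable Q = {}"
    proof (rule ccontr)
      assume "realizable P \<inter> realizable Q \<noteq> {}"
      then obtain ws where "ws \<in> realizable P" "ws \<in> realizable Q" by auto
      then have "length (w # ws) = Suc j \<and> set (w # ws) \<subseteq> W \<and> has_tree R (w # ws) Y"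
        using w by (auto simp: realizable_def)
      then show False using Suc.prems(4) by blast
    qed
    have large: "2 ^ e \<le> card (realizable Z)" if "Z \<subseteq> Y" "(2 ^ Suc t) ^ e * D \<le> card Z" for Z
    proof (rule Suc.IH[OF _ _ that(2)])
      show "finite Z" "Z \<subseteq> U" using that(1) Suc.prems(1,2) finite_subset by auto
      show "\<nexists>ws. length ws = Suc j \<and> set ws \<subseteq> W \<and> has_tree R ws Z"
        using Suc.prems(4) that(1) has_tree_mono by blast
    qed
    have "2 ^ Suc e \<le> card (realizable P) + card (realizable Q)"
      using large[OF w(2,4)] large[OF w(3,5)] by simp
    also have "\<dots> = card (realizable P \<union> realizable Q)" using disj finR by (simp add: card_Un_disjoint)
    also have "\<dots> \<le> card (realizable Y)" using sub finR by (intro card_mono) auto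
    finally show ?case .
  qed
  \<comment> \<open>Each of the \<open>t * j + 1\<close> nested splits costs a factor
    \<open>2 ^ Suc t\<close>, and \<open>D\<close> must remain for trees of depth \<open>j\<close>.
    The increment of the square from \<open>j\<close> to \<open>Suc j\<close> pays for this.\<close>
  have "Suc t * Suc (t * j) + (Suc t * j)\<^sup>2 \<le> (Suc t * Suc j)\<^sup>2"
    by (simp add: power2_eq_square algebra_simps)
  then have "(2::nat) ^ (Suc t * Suc (t * j) + (Suc t * j)\<^sup>2) \<le> 2 ^ ((Suc t * Suc j)\<^sup>2)"
    by (intro power_increasing) auto
  then have "(2 ^ Suc t) ^ Suc (t * j) * D \<le> card X"
    using Suc.prems(3) unfolding D_def power_add power_mult by linarith
  then have "2 ^ Suc (t * j) \<le> card (realizable X)"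
    if "\<nexists>ws. length ws = Suc j \<and> set ws \<subseteq> W \<and> has_tree R ws X"
    using growth Suc.prems that by blast
  then show ?case using cardR[of X] by (force dest: order_trans)
qed

section \<open>Monotone subsequences\<close>

text \<open>Induction on \<open>a\<close>: either the left-to-right minima contain a decreasing
  sequence of length \<open>Suc b\<close>, or discarding these at most \<open>b\<close> points
  leaves more than \<open>a * b\<close>.\<close>

lemma erdos_szekeres:
  fixes f :: "'a::linorder \<Rightarrow> 'b::linorder"
  assumes "finite S" "inj_on f S" "a * b < card S"
  shows "(\<exists>I\<subseteq>S. card I = Suc a \<and> strict_mono_on I f) \<or>
    (\<exists>I\<subseteq>S. card I = Suc b \<and> strict_antimono_on I f)"
  using assms
proof (induction a arbitrary: S)
  case 0
  then obtain x where "x \<in> S" by fastforce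
  then have "{x} \<subseteq> S \<and> card {x} = Suc 0 \<and> strict_mono_on {x} f" by (auto simp: strict_mono_on_def)
  then show ?case by metis
next
  case (Suc a)
  \<comment> \<open>The left-to-right minima; any increasing sequence avoiding them can be prolonged to the left.\<close>
  define M where "M = {x\<in>S. \<forall>y\<in>S. y < x \<longrightarrow> f x < f y}"
  have M: "M \<subseteq> S" "finite M" using Suc.prems by (auto simp: M_def)
  have antiM: "strict_antimono_on M f" by (auto simp: M_def monotone_on_def)
  show ?case
  proof (cases "Suc b \<le> card M")
    case True
    then obtain I where "I \<subseteq> M" "card I = Suc b" by (metis obtain_subset_with_card_n)
    then show ?thesis using M antiM by (meson monotone_on_subset order_trans)
  next
    case False
    have "a * b < card (S - M)"
      using False Suc.prems M by (simp add: card_Diff_subset)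
    moreover have "inj_on f (S - M)" using Suc.prems inj_on_subset by blast
    ultimately consider I where "I \<subseteq> S - M" "card I = Suc a" "strict_mono_on I f"
      | "\<exists>I\<subseteq>S. card I = Suc b \<and> strict_antimono_on I f"
      using Suc.IH[of "S - M"] Suc.prems(1) by blast
    then show ?thesis
    proof cases
      case 1
      have fin: "finite I" "I \<noteq> {}" using 1(2) by (auto intro: card_ge_0_finite)
      define x where "x = Min I"
      have x: "x \<in> I" "\<And>z. z \<in> I \<Longrightarrow> x \<le> z" using fin by (auto simp: x_def)
      then obtain y where y: "y \<in> S" "y < x" "\<not> f x < f y" using 1(1) by (auto simp: M_def)
      have "f x \<noteq> f y" using y x 1(1) Suc.prems(2) by (metis DiffD1 inj_onD less_irrefl subsetD)
      then have fy: "f y < f z" if "z \<in> I" for z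
        using y x(1) x(2)[OF that] 1(3) that
        by (metis linorder_less_linear order_le_less order_less_trans strict_mono_onD)
      have less: "y < z" if "z \<in> I" for z using y x(2)[OF that] by order
      have "strict_mono_on (insert y I) f"
      proof (rule strict_mono_onI)
        fix u v assume uv: "u \<in> insert y I" "v \<in> insert y I" "u < v"
        then have "v \<in> I" using less[of u] by force
        then show "f u < f v" using uv fy strict_mono_onD[OF 1(3)] by blast
      qed
      moreover have "y \<notin> I" using less by blast
      then have "card (insert y I) = Suc (Suc a)" using 1(2) fin by simp
      ultimately show ?thesis using y 1(1) by (metis Diff_subset insert_subset order_trans)
    qed auto
  qed
qed

section \<open>A common subset of many dense sets\<close>

text \<open>Greedy choice of \<open>T\<close>: on average a point of \<open>U\<close> lies in at
  least a quarter of the sets \<open>Z b\<close>, so some point does. Only the sets containing it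
  are kept, the point is deleted from \<open>U\<close>, and the choice is repeated; each of the
  \<open>k\<close> rounds costs a factor 4.\<close>

lemma common_subset:
  assumes "finite F" "F \<noteq> {}" "finite U" "\<And>b. b \<in> F \<Longrightarrow> Z b \<subseteq> U \<and> z \<le> card (Z b)"
    \<comment> \<open>invariant under decreasing all of \<open>card U\<close>, \<open>z\<close>, \<open>k\<close> by one; it keeps \<open>z / card U\<close> at least 1/4\<close>
    and "card U + 3 * k \<le> 4 * z"
  shows "\<exists>T\<subseteq>U. card T = k \<and> card F \<le> 4 ^ k * card {b\<in>F. T \<subseteq> Z b}"
  using assms
proof (induction k arbitrary: F U Z z)
  case 0
  then show ?case by (intro exI[of _ "{}"]) auto
next
  case (Suc k)
  have "card F * z \<le> (\<Sum>b\<in>F. card (Z b))"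
    using Suc.prems(4) sum_bounded_below[of F z "\<lambda>b. card (Z b)"] by simp
  also have "\<dots> = (\<Sum>b\<in>F. card {u\<in>U. u \<in> Z b})"
    by (intro sum.cong refl arg_cong[where f = card]) (use Suc.prems(4) in auto)
  also have "\<dots> = (\<Sum>u\<in>U. card {b\<in>F. u \<in> Z b})"
    by (rule sum_multicount_gen) (use Suc.prems in auto)
  finally have double_count: "card F * z \<le> (\<Sum>u\<in>U. card {b\<in>F. u \<in> Z b})" .
  have F0: "card F > 0" using Suc.prems by auto
  have "\<exists>u\<in>U. card F \<le> 4 * card {b\<in>F. u \<in> Z b}"
  proof (rule ccontr)
    assume "\<not> ?thesis"
    then have less: "4 * card {b\<in>F. u \<in> Z b} \<le> card F - 1" if "u \<in> U" for u
      using that by force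
    \<comment> \<open>As \<open>card U \<le> 4 * z\<close>, the double count falls short; strictness
      comes from \<open>card F - 1\<close> together with \<open>0 < z\<close>.\<close>
    have "4 * (card F * z) \<le> (\<Sum>u\<in>U. 4 * card {b\<in>F. u \<in> Z b})"
      using double_count by (simp flip: sum_distrib_left)
    also have "\<dots> \<le> card U * (card F - 1)"
      using sum_bounded_above[of U _ "card F - 1", OF less] by simp
    also have "\<dots> \<le> (4 * z) * (card F - 1)" using Suc.prems(5) by (intro mult_right_mono) auto
    also have "\<dots> < 4 * (card F * z)" using F0 Suc.prems(5) by (simp add: algebra_simps)
    finally show False by simp
  qed
  then obtain u where u: "u \<in> U" "card F \<le> 4 * card {b\<in>F. u \<in> Z b}" by auto
  let ?F = "{b\<in>F. u \<in> Z b}"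
  have "\<exists>T\<subseteq>U - {u}. card T = k \<and> card ?F \<le> 4 ^ k * card {b\<in>?F. T \<subseteq> Z b - {u}}"
  proof (rule Suc.IH)
    show "finite ?F" "finite (U - {u})" using Suc.prems by auto
    show "?F \<noteq> {}" using u F0 by (metis card.empty mult_0_right not_le)
    show "card (U - {u}) + 3 * k \<le> 4 * (z - 1)" proof -
      have "card U > 0" using u(1) Suc.prems(3) card_gt_0_iff by blast
      then show ?thesis using u(1) Suc.prems(3,5) by (simp add: card_Diff_singleton)
    qed
    show "Z b - {u} \<subseteq> U - {u} \<and> z - 1 \<le> card (Z b - {u})" if "b \<in> ?F" for b
      using Suc.prems(4)[of b] that by (auto simp: card_Diff_singleton)
  qed
  then obtain T where T: "T \<subseteq> U - {u}" "card T = k"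
    "card ?F \<le> 4 ^ k * card {b\<in>?F. T \<subseteq> Z b - {u}}" by auto
  have "{b\<in>?F. T \<subseteq> Z b - {u}} \<subseteq> {b\<in>F. insert u T \<subseteq> Z b}" by auto
  then have "card {b\<in>?F. T \<subseteq> Z b - {u}} \<le> card {b\<in>F. insert u T \<subseteq> Z b}"
    using Suc.prems(1) by (intro card_mono) auto
  then have "4 ^ k * card {b\<in>?F. T \<subseteq> Z b - {u}} \<le> 4 ^ k * card {b\<in>F. insert u T \<subseteq> Z b}"
    by (rule mult_left_mono) simp
  with u(2) T(3) have "card F \<le> 4 ^ Suc k * card {b\<in>F. insert u T \<subseteq> Z b}"
    unfolding power_Suc by linarith
  moreover have "card (insert u T) = Suc k"
    using T(1,2) Suc.prems(3) finite_subset[of T U] by (subst card_insert_disjoint) auto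
  ultimately show ?case using T u by (intro exI[of _ "insert u T"]) auto
qed

section \<open>Criteria for lex-monotonicity\<close>

lemma lex_less_iff: "lex_less (a, b) (c, d) \<longleftrightarrow> a < c \<or> a = c \<and> b < d"
  by (auto simp: lex_less_def)

text \<open>The lexicographic order is total on distinct keys, so the forward implication for all
  pairs already rules out the reverse outcome.\<close>

lemma less_iff_lex_less:
  fixes A :: "int \<times> int \<Rightarrow> real"
  assumes "\<And>p q. p \<in> D \<Longrightarrow> q \<in> D \<Longrightarrow> lex_less (key p) (key q) \<Longrightarrow> A p < A q"
    and "inj_on key D" "p \<in> D" "q \<in> D"
  shows "A p < A q \<longleftrightarrow> lex_less (key p) (key q)"
proof -
  have "lex_less (key p) (key q) \<or> key p = key q \<or> lex_less (key q) (key p)"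
    by (cases "key p"; cases "key q") (auto simp: lex_less_iff)
  then show ?thesis
    using assms(1)[of p q] assms(1)[of q p] inj_onD[OF assms(2)] assms(3,4) by fastforce
qed

text \<open>The identity permutation makes the row dominant. Positions in different rows are settled
  by the third hypothesis whatever their columns, positions in the same row by the fourth.\<close>

lemma lex_monotone_row_major:
  assumes "e \<in> {-1, 1}" "d \<in> {-1, 1}"
    and "\<And>a a' b b'. a \<in> S \<Longrightarrow> a' \<in> S \<Longrightarrow> b \<in> T \<Longrightarrow> b' \<in> T \<Longrightarrow> e * a < e * a' \<Longrightarrow> A (a, b) < A (a', b')"
    and "\<And>a b b'. a \<in> S \<Longrightarrow> b \<in> T \<Longrightarrow> b' \<in> T \<Longrightarrow> d * b < d * b' \<Longrightarrow> A (a, b) < A (a, b')"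
  shows "lex_monotone S T A"
proof -
  let ?s = "\<lambda>i::nat. if i = 1 then e else d"
  let ?key = "\<lambda>p. (e * fst p, d * snd p)"
  have "A p < A q \<longleftrightarrow> lex_less (?key p) (?key q)" if "p \<in> S \<times> T" "q \<in> S \<times> T" for p q
  proof (rule less_iff_lex_less[OF _ _ that])
    show "inj_on ?key (S \<times> T)" using assms(1,2) by (auto intro!: inj_onI)
    show "A p < A q" if "p \<in> S \<times> T" "q \<in> S \<times> T" "lex_less (?key p) (?key q)" for p q
    proof -
      obtain a b a' b' where pq: "p = (a, b)" "q = (a', b')" by (cases p; cases q)
      have "e * a < e * a' \<or> a = a' \<and> d * b < d * b'"
        using that(3) assms(1) by (auto simp: pq lex_less_iff)
      then show "A p < A q" using assms(3)[of a a' b b'] assms(4)[of a b b'] that(1,2) by (auto simp: pq)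
    qed
  qed
  then have "\<forall>p\<in>S \<times> T. \<forall>q\<in>S \<times> T. A p < A q \<longleftrightarrow>
    lex_less (?s (id 1) * coord (id 1) p, ?s (id 2) * coord (id 2) p)
             (?s (id 1) * coord (id 1) q, ?s (id 2) * coord (id 2) q)"
    by (simp add: coord_def)
  moreover have "\<forall>i\<in>{1, 2::nat}. ?s i \<in> {-1, 1}" using assms(1,2) by simp
  ultimately show ?thesis
    unfolding lex_monotone_def using permutes_id[of "{1, 2::nat}"]
    by (intro exI[of _ id] exI[of _ ?s] conjI)
qed

text \<open>The transposition makes the column dominant; \<open>e\<close> remains the row sign and
  \<open>d\<close> the column sign.\<close>

lemma lex_monotone_column_major:
  assumes "e \<in> {-1, 1}" "d \<in> {-1, 1}"
    and "\<And>a a' b b'. a \<in> S \<Longrightarrow> a' \<in> S \<Longrightarrow> b \<in> T \<Longrightarrow> b' \<in> T \<Longrightarrow> d * b < d * b' \<Longrightarrow> A (a, b) < A (a', b')"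
    and "\<And>a a' b. a \<in> S \<Longrightarrow> a' \<in> S \<Longrightarrow> b \<in> T \<Longrightarrow> e * a < e * a' \<Longrightarrow> A (a, b) < A (a', b)"
  shows "lex_monotone S T A"
proof -
  let ?s = "\<lambda>i::nat. if i = 1 then e else d"
  let ?\<sigma> = "transpose 1 (2::nat)"
  let ?key = "\<lambda>p. (d * snd p, e * fst p)"
  have "A p < A q \<longleftrightarrow> lex_less (?key p) (?key q)" if "p \<in> S \<times> T" "q \<in> S \<times> T" for p q
  proof (rule less_iff_lex_less[OF _ _ that])
    show "inj_on ?key (S \<times> T)" using assms(1,2) by (auto intro!: inj_onI)
    show "A p < A q" if "p \<in> S \<times> T" "q \<in> S \<times> T" "lex_less (?key p) (?key q)" for p q
    proof -
      obtain a b a' b' where pq: "p = (a, b)" "q = (a', b')" by (cases p; cases q)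
      have "d * b < d * b' \<or> b = b' \<and> e * a < e * a'"
        using that(3) assms(2) by (auto simp: pq lex_less_iff)
      then show "A p < A q" using assms(3)[of a a' b b'] assms(4)[of a a' b] that(1,2) by (auto simp: pq)
    qed
  qed
  then have "\<forall>p\<in>S \<times> T. \<forall>q\<in>S \<times> T. A p < A q \<longleftrightarrow>
    lex_less (?s (?\<sigma> 1) * coord (?\<sigma> 1) p, ?s (?\<sigma> 2) * coord (?\<sigma> 2) p)
             (?s (?\<sigma> 1) * coord (?\<sigma> 1) q, ?s (?\<sigma> 2) * coord (?\<sigma> 2) q)"
    by (simp add: coord_def)
  moreover have "\<forall>i\<in>{1, 2::nat}. ?s i \<in> {-1, 1}" using assms(1,2) by simp
  moreover have "?\<sigma> permutes {1, 2}" by (rule permutes_swap_id) auto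
  ultimately show ?thesis
    unfolding lex_monotone_def by (intro exI[of _ ?\<sigma>] exI[of _ ?s] conjI)
qed

section \<open>Rows on which many columns are monotone\<close>

text \<open>Among \<open>m * m\<close> fixed rows, each column is monotone on some \<open>m\<close>
  of them. A set of rows and a direction form one of \<open>2 ^ Suc (m * m)\<close> pairs, so at
  least \<open>Q\<close> columns share a pair. The enumeration \<open>r\<close> lists the rows by
  increasing entries, and \<open>e\<close> tells whether their indices increase or decrease.\<close>

lemma monotone_rows:
  fixes A :: "int \<times> int \<Rightarrow> real"
  assumes "finite S1" "finite S2" "inj_on A (S1 \<times> S2)"
    and "0 < m" "m * m \<le> card S1" "0 < Q" "2 ^ Suc (m * m) * Q \<le> card S2"
  shows "\<exists>e\<in>{-1, 1}. \<exists>r. \<exists>Y\<subseteq>S2. Q \<le> card Y \<and> (\<forall>i<m. r i \<in> S1) \<and>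
    (\<forall>i j. i < j \<longrightarrow> j < m \<longrightarrow> e * r i < e * r j \<and> (\<forall>y\<in>Y. A (r i, y) < A (r j, y)))"
proof -
  obtain R where R: "R \<subseteq> S1" "card R = m * m" "finite R"
    using obtain_subset_with_card_n[OF assms(5)] by blast
  define good where "good = (\<lambda>y (I, up).
    card I = m \<and> (if up then strict_mono_on I (\<lambda>x. A (x, y)) else strict_antimono_on I (\<lambda>x. A (x, y))))"
  have "\<exists>p. p \<in> Pow R \<times> UNIV \<and> good y p" if "y \<in> S2" for y
  proof -
    have "inj_on (\<lambda>x. A (x, y)) R"
    proof (rule inj_onI)
      fix u v assume "u \<in> R" "v \<in> R" "A (u, y) = A (v, y)"
      then show "u = v" using inj_onD[OF assms(3), of "(u, y)" "(v, y)"] R(1) that by auto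
    qed
    moreover have "(m - 1) * (m - 1) < card R"
      using assms(4) R by (simp add: mult_strict_mono)
    ultimately consider I where "I \<subseteq> R" "card I = m" "strict_mono_on I (\<lambda>x. A (x, y))"
      | I where "I \<subseteq> R" "card I = m" "strict_antimono_on I (\<lambda>x. A (x, y))"
      using erdos_szekeres[of R "\<lambda>x. A (x, y)" "m - 1" "m - 1"] R(3) assms(4) by auto
    then show ?thesis
    proof cases
      case 1
      then show ?thesis by (intro exI[of _ "(I, True)"]) (auto simp: good_def)
    next
      case 2
      then show ?thesis by (intro exI[of _ "(I, False)"]) (auto simp: good_def)
    qed
  qed
  then obtain c where c: "\<And>y. y \<in> S2 \<Longrightarrow> c y \<in> Pow R \<times> UNIV \<and> good y (c y)" by metis
  have "\<exists>p\<in>Pow R \<times> (UNIV :: bool set). card (c -` {p} \<inter> S2) * card (Pow R \<times> (UNIV :: bool set)) \<ge> card S2"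
    by (rule pigeonhole_card) (use c assms(2) R(3) in \<open>auto simp: finite_cartesian_product\<close>)
  then obtain p where p: "p \<in> Pow R \<times> UNIV"
    "card (c -` {p} \<inter> S2) * card (Pow R \<times> (UNIV :: bool set)) \<ge> card S2" by blast
  define Y where "Y = c -` {p} \<inter> S2"
  have cards: "card (Pow R \<times> (UNIV :: bool set)) = 2 ^ Suc (m * m)"
    using R by (simp add: card_cartesian_product card_Pow)
  have "2 ^ Suc (m * m) * Q \<le> 2 ^ Suc (m * m) * card Y"
    using p(2) assms(7) unfolding cards Y_def[symmetric] by (metis le_trans mult.commute)
  then have QY: "Q \<le> card Y" by (simp only: mult_le_cancel1) simp
  have YS: "Y \<subseteq> S2" by (auto simp: Y_def)
  obtain I up where I: "p = (I, up)" "I \<subseteq> R" using p(1) by auto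
  have mono: "if up then strict_mono_on I (\<lambda>x. A (x, y)) else strict_antimono_on I (\<lambda>x. A (x, y))"
    and cardI: "card I = m" if "y \<in> Y" for y
    using c[of y] that I by (auto simp: Y_def good_def)
  have "Y \<noteq> {}" using QY assms(6) by auto
  then have cI: "card I = m" and finI: "finite I" using cardI I R finite_subset by auto
  let ?l = "sorted_list_of_set I"
  have len: "length ?l = m" and set: "set ?l = I" and srt: "sorted_wrt (<) ?l"
    using cI finI strict_sorted_list_of_set by auto
  have nth_in: "?l ! i \<in> I" "?l ! i \<in> S1" if "i < m" for i
    using I(2) R(1) nth_mem[of i ?l] that len set by auto
  have less: "?l ! i < ?l ! j" if "i < j" "j < m" for i j
    using sorted_wrt_nth_less[OF srt that(1)] that len by auto
  show ?thesis
  proof (cases up)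
    case True
    then have "A (?l ! i, y) < A (?l ! j, y)" if "i < j" "j < m" "y \<in> Y" for i j y
      using mono[OF that(3)] less[OF that(1,2)] nth_in[of i] nth_in[of j] that
      by (auto simp: monotone_on_def)
    then show ?thesis using QY YS less nth_in
      by (intro bexI[of _ 1] exI[of _ "\<lambda>i. ?l ! i"] exI[of _ Y]) auto
  next
    case False
    \<comment> \<open>For decreasing columns the rows are listed backwards, so that entries still
      increase along the list; the index order is reversed instead, whence sign -1.\<close>
    have less': "?l ! (m - Suc j) < ?l ! (m - Suc i)" if "i < j" "j < m" for i j
      using that by (intro less) auto
    have "A (?l ! (m - Suc i), y) < A (?l ! (m - Suc j), y)" if "i < j" "j < m" "y \<in> Y" for i j y
      using mono[OF that(3)] False less'[OF that(1,2)] nth_in[of "m - Suc i"] nth_in[of "m - Suc j"] that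
      by (auto simp: monotone_on_def)
    then show ?thesis using QY YS less' nth_in
      by (intro bexI[of _ "-1"] exI[of _ "\<lambda>i. ?l ! (m - Suc i)"] exI[of _ Y]) auto
  qed
qed

section \<open>Extracting a lex-monotone subarray from monotone columns\<close>

text \<open>In \<open>N = 2 * n * 4 ^ k\<close> the factor 2 pays for choosing the direction of the
  first rows, \<open>4 ^ k\<close> for the loss in \<open>common_subset\<close>, and
  \<open>n\<close> blocks survive. The tree has depth \<open>8 * k\<close> and labels in
  \<open>Pow tests\<close>, of size \<open>2 ^ (3 * N)\<close>.\<close>

lemma lex_monotone_from_monotone_rows:
  fixes A :: "int \<times> int \<Rightarrow> real" and r :: "nat \<Rightarrow> int"
  assumes e: "e \<in> {-1, 1}" and "finite Y" "0 < n" "n \<le> 2 ^ k" and N: "N = 2 * n * 4 ^ k"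
    and rmono: "\<And>i j. i < j \<Longrightarrow> j < n * N \<Longrightarrow> e * r i < e * r j"
    and cmono: "\<And>i j y. i < j \<Longrightarrow> j < n * N \<Longrightarrow> y \<in> Y \<Longrightarrow> A (r i, y) < A (r j, y)"
    and neq: "\<And>i j x y. i < n * N \<Longrightarrow> j < n * N \<Longrightarrow> x \<in> Y \<Longrightarrow> y \<in> Y \<Longrightarrow> x \<noteq> y \<Longrightarrow>
      A (r i, x) \<noteq> A (r j, y)"
    and size: "2 ^ ((Suc (3 * N) * (8 * k))\<^sup>2) \<le> card Y"
  shows "\<exists>S\<subseteq>r ` {..<n * N}. \<exists>T\<subseteq>Y. card S = n \<and> card T = n \<and> lex_monotone S T A"
proof -
  \<comment> \<open>Block \<open>b\<close> consists of the \<open>n\<close> rows with indices from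
    \<open>fst_row b\<close> to \<open>lst_row b\<close>. Entries increase along \<open>r\<close>,
    so in each column these two rows hold the extreme entries of the block.\<close>
  define fst_row where "fst_row b = n * b" for b :: nat
  define lst_row where "lst_row b = n * b + (n - 1)" for b :: nat
  have lst_less: "lst_row b < n * b'" if "b < b'" for b b'
  proof -
    have "n * Suc b \<le> n * b'" using that by (intro mult_left_mono) auto
    then show ?thesis using \<open>0 < n\<close> by (simp add: lst_row_def)
  qed
  have rows: "fst_row b < n * N" "lst_row b < n * N" if "b < N" for b
    using lst_less[OF that] that \<open>0 < n\<close> by (auto simp: fst_row_def lst_row_def)
  \<comment> \<open>For columns \<open>x < y\<close> and the rows of block \<open>b\<close>: test 0 holds iff all entries of \<open>x\<close> lie below
    those of \<open>y\<close>, test 1 fails iff they all lie above, and if neither happens then test 2 is the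
    direction of the first row.\<close>
  define tests where "tests = {..<N} \<times> {0, 1, 2::nat}"
  define lhs where "lhs = (\<lambda>(b, c::nat) x. A (r (if c = 0 then lst_row b else fst_row b), x))"
  define rhs where "rhs = (\<lambda>(b, c::nat) y. A (r (if c = 1 then lst_row b else fst_row b), y))"
  define R where "R w x y \<longleftrightarrow> x < y \<and>
    (\<forall>t\<in>tests. if t \<in> w then lhs t x < rhs t y else rhs t y < lhs t x)" for w x y
  have tests: "finite tests" "card tests = 3 * N"
    by (simp_all add: tests_def card_cartesian_product)
  have neq': "lhs t x \<noteq> rhs t y" if "t \<in> tests" "x \<in> Y" "y \<in> Y" "x \<noteq> y" for t x y
    using that neq[of _ _ x y] rows by (auto simp: tests_def lhs_def rhs_def)
  have split: "\<exists>w\<in>Pow tests. \<exists>P\<subseteq>X. \<exists>Q\<subseteq>X. s \<le> card P \<and> s \<le> card Q \<and> (\<forall>y\<in>P. \<forall>z\<in>Q. R w y z)"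
    if X: "finite X" "2 ^ Suc (3 * N) * s \<le> card X" "X \<subseteq> Y" for X s
  proof -
    \<comment> \<open>Cutting \<open>X\<close> by column index first ensures \<open>x < y\<close>
      across the split; this is the extra factor 2 in \<open>2 ^ Suc (3 * N)\<close>.\<close>
    have "2 ^ (3 * N) * s \<le> card X" using X(2) by simp
    from finite_lower_part[OF X(1) this, of "\<lambda>x. x"] obtain L where
      L: "L \<subseteq> X" "card L = 2 ^ (3 * N) * s" "\<forall>x\<in>L. \<forall>y\<in>X - L. x \<le> y" by auto
    have fin: "finite L" "finite (X - L)" using L X finite_subset by auto
    have "card (X - L) = card X - card L" using L fin by (simp add: card_Diff_subset)
    then have cards: "2 ^ card tests * s \<le> card L" "2 ^ card tests * s \<le> card (X - L)"
      using L X by (simp_all add: tests)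
    have "\<exists>w\<subseteq>tests. \<exists>P\<subseteq>L. \<exists>Q\<subseteq>X - L. s \<le> card P \<and> s \<le> card Q \<and>
      (\<forall>t\<in>tests. \<forall>x\<in>P. \<forall>y\<in>Q. if t \<in> w then lhs t x < rhs t y else rhs t y < lhs t x)"
    proof (rule separate_all[OF tests(1) fin cards])
      show "lhs t x \<noteq> rhs t y" if "t \<in> tests" "x \<in> L" "y \<in> X - L" for t x y
        using that L(1) X(3) by (intro neq') auto
    qed
    then obtain w P Q where
      w: "w \<subseteq> tests" "P \<subseteq> L" "Q \<subseteq> X - L" "s \<le> card P" "s \<le> card Q"
      "\<forall>t\<in>tests. \<forall>x\<in>P. \<forall>y\<in>Q. if t \<in> w then lhs t x < rhs t y else rhs t y < lhs t x"
      by (elim exE conjE) (rule that)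
    have "R w y z" if "y \<in> P" "z \<in> Q" for y z
    proof -
      have "y \<in> L" "z \<in> X - L" using that w(2,3) by auto
      then have "y < z" using L(3) by (metis DiffD2 order_le_less)
      then show ?thesis using w(6) that by (simp add: R_def)
    qed
    then show ?thesis using w L(1) by (intro bexI[of _ w] exI[of _ P] exI[of _ Q]) auto
  qed
  obtain ws where ws: "length ws = 8 * k" "has_tree R ws Y"
    using exists_tree[of "Pow tests" "3 * N" Y R Y "8 * k", OF _ _ split]
      \<open>finite Y\<close> size tests by (auto simp: card_Pow)
  \<comment> \<open>Restricting the tree to \<open>k\<close> levels leaves
    \<open>2 ^ k \<ge> n\<close> leaves. Since \<open>R\<close> includes \<open>x < y\<close>, any
    two of the chosen columns are related in their natural order.\<close>
  have leaves: "\<exists>T\<subseteq>Y. card T = n \<and> (\<forall>x\<in>T. \<forall>y\<in>T. x < y \<longrightarrow> (\<exists>i\<in>P. R (ws ! i) x y))"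
    if P: "P \<subseteq> {..<8 * k}" "card P = k" for P
  proof -
    have "{i. i < length ws \<and> i \<in> P} = P" using P ws by auto
    then have len: "length (nths ws P) = k" using P by (simp add: length_nths)
    obtain S where S: "S \<subseteq> Y" "card S = 2 ^ k"
      "\<forall>x\<in>S. \<forall>y\<in>S. x \<noteq> y \<longrightarrow> (\<exists>w\<in>set (nths ws P). R w x y \<or> R w y x)"
      using has_tree_leaves[OF has_tree_nths[OF ws(2), of P]] len by (auto simp: R_def)
    obtain T where T: "T \<subseteq> S" "card T = n"
      using obtain_subset_with_card_n[of n S] S \<open>n \<le> 2 ^ k\<close> by metis
    have "\<exists>i\<in>P. R (ws ! i) x y" if "x \<in> T" "y \<in> T" "x < y" for x y
    proof -
      have "x \<in> S" "y \<in> S" "x \<noteq> y" using T(1) that by auto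
      then obtain w where w: "w \<in> set (nths ws P)" "R w x y \<or> R w y x"
        using S(3) by blast
      then have "R w x y" using that(3) by (auto simp: R_def)
      then show ?thesis using w(1) by (auto simp: set_nths)
    qed
    then show ?thesis using T S(1) by (intro exI[of _ T]) auto
  qed
  have rowI: "e * r i < e * r j" "A (r i, y) < A (r j, y)" if "i < j" "j < n * N" "y \<in> Y" for i j y
    using rmono cmono that by simp_all
  have r_less_iff: "e * r i < e * r j \<longleftrightarrow> i < j" if "i < n * N" "j < n * N" for i j
    using rmono[of i j] rmono[of j i] that
    by (cases i j rule: linorder_cases) auto
  have inj_r: "inj_on r {..<n * N}"
  proof (rule inj_onI)
    fix i j assume ij: "i \<in> {..<n * N}" "j \<in> {..<n * N}" "r i = r j"
    then have "\<not> i < j" "\<not> j < i" using r_less_iff[of i j] r_less_iff[of j i] by auto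
    then show "i = j" by simp
  qed
  have row_le: "A (r i, y) \<le> A (r j, y)" if "i \<le> j" "j < n * N" "y \<in> Y" for i j y
    using cmono[of i j y] that by (cases "i = j") auto
  define lev where "lev b c = {i. i < 8 * k \<and> (b, c) \<in> ws ! i}" for b c
  have R_lt: "lhs (b, c) x < rhs (b, c) y" if "R (ws ! i) x y" "i \<in> lev b c" "b < N" "c < 3" for i x y b c
  proof -
    have "(b, c) \<in> tests" using that by (auto simp: tests_def)
    then have "if (b, c) \<in> ws ! i then lhs (b, c) x < rhs (b, c) y else rhs (b, c) y < lhs (b, c) x"
      using that(1) unfolding R_def by blast
    then show ?thesis using that(2,3) by (simp add: lev_def)
  qed
  have R_gt: "rhs (b, c) y < lhs (b, c) x" if "R (ws ! i) x y" "i < 8 * k" "i \<notin> lev b c" "b < N" "c < 3" for i x y b c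
  proof -
    have "(b, c) \<in> tests" using that by (auto simp: tests_def)
    then have "if (b, c) \<in> ws ! i then lhs (b, c) x < rhs (b, c) y else rhs (b, c) y < lhs (b, c) x"
      using that(1) unfolding R_def by blast
    then show ?thesis using that(2,3) by (simp add: lev_def)
  qed
  \<comment> \<open>Separating the last row of one column from the first row of another separates
    all entries of the block, so one whole block gives a column-major subarray.\<close>
  have block: ?thesis
    if b: "b < N" and d: "d \<in> {-1, 1}" and T: "T \<subseteq> Y" "card T = n"
      and sep: "\<And>x y. x \<in> T \<Longrightarrow> y \<in> T \<Longrightarrow> d * x < d * y \<Longrightarrow> A (r (lst_row b), x) < A (r (fst_row b), y)"
    for b d T
  proof -
    let ?I = "{fst_row b..lst_row b}"
    have I: "i < n * N" if "i \<in> ?I" for i using that rows[OF b] by auto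
    then have "?I \<subseteq> {..<n * N}" by auto
    then have "card (r ` ?I) = card ?I" by (intro card_image inj_on_subset[OF inj_r])
    then have "card (r ` ?I) = n" using \<open>0 < n\<close> by (simp add: fst_row_def lst_row_def)
    moreover have "lex_monotone (r ` ?I) T A"
    proof (rule lex_monotone_column_major[OF e d])
      fix a a' x y assume *: "a \<in> r ` ?I" "a' \<in> r ` ?I" "x \<in> T" "y \<in> T" "d * x < d * y"
      then obtain i j where ij: "a = r i" "a' = r j" "i \<in> ?I" "j \<in> ?I" by auto
      have "A (r i, x) \<le> A (r (lst_row b), x)" "A (r (fst_row b), y) \<le> A (r j, y)"
        using ij(3,4) I rows[OF b] T(1) * by (auto intro!: row_le)
      then show "A (a, x) < A (a', y)" using sep[of x y] * ij by simp
    next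
      fix a a' x assume *: "a \<in> r ` ?I" "a' \<in> r ` ?I" "x \<in> T" "e * a < e * a'"
      then obtain i j where ij: "a = r i" "a' = r j" "i \<in> ?I" "j \<in> ?I" by auto
      then have "i < j" using * r_less_iff I by auto
      then show "A (a, x) < A (a', x)" using ij I * T(1) by (auto intro!: rowI)
    qed
    ultimately show ?thesis using T I
      by (intro exI[of _ "r ` ?I"] exI[of _ T]) auto
  qed
  show ?thesis
  proof (cases "\<exists>b<N. k \<le> card (lev b 0) \<or> k \<le> card ({..<8 * k} - lev b 1)")
    case True
    then obtain b where b: "b < N" "k \<le> card (lev b 0) \<or> k \<le> card ({..<8 * k} - lev b 1)" by auto
    from b(2) show ?thesis
    proof
      assume "k \<le> card (lev b 0)"
      then obtain P where P: "P \<subseteq> lev b 0" "card P = k" using obtain_subset_with_card_n by metis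
      then have "P \<subseteq> {..<8 * k}" by (auto simp: lev_def)
      from leaves[OF this P(2)] obtain T where T: "T \<subseteq> Y" "card T = n"
        "\<And>x y. x \<in> T \<Longrightarrow> y \<in> T \<Longrightarrow> x < y \<Longrightarrow> \<exists>i\<in>P. R (ws ! i) x y" by blast
      show ?thesis
      proof (rule block[OF b(1) _ T(1,2), of 1])
        fix x y :: int assume "x \<in> T" "y \<in> T" "1 * x < 1 * y"
        then obtain i where i: "i \<in> P" "R (ws ! i) x y" using T(3)[of x y] by auto
        then show "A (r (lst_row b), x) < A (r (fst_row b), y)"
          using R_lt[OF i(2), of b 0] P b by (auto simp: lhs_def rhs_def)
      qed simp
    next
      assume "k \<le> card ({..<8 * k} - lev b 1)"
      then obtain P where P: "P \<subseteq> {..<8 * k} - lev b 1" "card P = k"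
        using obtain_subset_with_card_n by metis
      then have "P \<subseteq> {..<8 * k}" by auto
      from leaves[OF this P(2)] obtain T where T: "T \<subseteq> Y" "card T = n"
        "\<And>x y. x \<in> T \<Longrightarrow> y \<in> T \<Longrightarrow> x < y \<Longrightarrow> \<exists>i\<in>P. R (ws ! i) x y" by blast
      show ?thesis
      \<comment> \<open>Failure of test 1 for \<open>x < y\<close> puts the last row of
        \<open>y\<close> below the first row of \<open>x\<close>, so later columns have smaller
        entries.\<close>
      proof (rule block[OF b(1) _ T(1,2), of "-1"])
        fix x y :: int assume "x \<in> T" "y \<in> T" "-1 * x < -1 * y"
        then obtain i where i: "i \<in> P" "R (ws ! i) y x" using T(3)[of y x] by auto
        then show "A (r (lst_row b), x) < A (r (fst_row b), y)"
          using R_gt[OF i(2), of b 1] P b by (auto simp: lhs_def rhs_def)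
      qed simp
    qed
  next
    case False
    define Z where "Z up b = {i \<in> {..<8 * k}. i \<notin> lev b 0 \<and> i \<in> lev b 1 \<and> (i \<in> lev b 2 \<longleftrightarrow> up)}"
      for up b
    define F where "F up = {b. b < N \<and> 3 * k \<le> card (Z up b)}" for up
    \<comment> \<open>Fewer than \<open>k\<close> levels have test 0 true and fewer than
      \<open>k\<close> have test 1 false, so more than \<open>6 * k\<close> interleaving levels are
      divided between the two directions.\<close>
    have "3 * k \<le> card (Z True b) \<or> 3 * k \<le> card (Z False b)" if "b < N" for b
    proof -
      have "card {..<8 * k} \<le> card ((lev b 0 \<union> ({..<8 * k} - lev b 1)) \<union> (Z True b \<union> Z False b))"
        by (rule card_mono) (auto simp: Z_def lev_def)
      also have "\<dots> \<le> (card (lev b 0) + card ({..<8 * k} - lev b 1)) + (card (Z True b) + card (Z False b))"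
        by (meson add_mono card_Un_le order_trans)
      finally show ?thesis using False that by force
    qed
    then have "{..<N} = F True \<union> F False" by (auto simp: F_def)
    then have "N \<le> card (F True) + card (F False)" by (metis card_Un_le card_lessThan)
    then have "n * 4 ^ k \<le> card (F True) \<or> n * 4 ^ k \<le> card (F False)"
      using N by linarith
    then obtain up where up: "n * 4 ^ k \<le> card (F up)" by metis
    \<comment> \<open>The density condition reads
      \<open>8 * k + 3 * k \<le> 4 * (3 * k)\<close>.\<close>
    have "\<exists>P\<subseteq>{..<8 * k}. card P = k \<and> card (F up) \<le> 4 ^ k * card {b\<in>F up. P \<subseteq> Z up b}"
    proof (rule common_subset[of _ _ _ "3 * k"])
      show "F up \<noteq> {}" using up \<open>0 < n\<close> by auto
    qed (auto simp: F_def Z_def)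
    then obtain P where P: "P \<subseteq> {..<8 * k}" "card P = k"
      "card (F up) \<le> 4 ^ k * card {b\<in>F up. P \<subseteq> Z up b}" by auto
    have "4 ^ k * n \<le> 4 ^ k * card {b\<in>F up. P \<subseteq> Z up b}" 
      using order_trans[OF up P(3)] by (simp only: mult.commute)
    then have "n \<le> card {b\<in>F up. P \<subseteq> Z up b}" by simp
    then obtain D where D: "D \<subseteq> {b\<in>F up. P \<subseteq> Z up b}" "card D = n"
      using obtain_subset_with_card_n by metis
    have DN: "b < N" "P \<subseteq> Z up b" if "b \<in> D" for b using D(1) that by (auto simp: F_def)
    from leaves[OF P(1,2)] obtain T where T: "T \<subseteq> Y" "card T = n"
      "\<And>x y. x \<in> T \<Longrightarrow> y \<in> T \<Longrightarrow> x < y \<Longrightarrow> \<exists>i\<in>P. R (ws ! i) x y" by blast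
    define d where "d = (if up then 1 else -1 :: int)"
    have d: "d \<in> {-1, 1}" by (simp add: d_def)
    \<comment> \<open>Success of test 1 gives this for \<open>x < y\<close>, failure of test 0 for
      \<open>y < x\<close>; hence it holds for distinct columns in either order.\<close>
    have interleaved: "A (r (fst_row b), x) < A (r (lst_row b), y)"
      if h: "b \<in> D" "x \<in> T" "y \<in> T" "x \<noteq> y" for b x y
    proof (cases "x < y")
      case True
      then obtain i where i: "i \<in> P" "R (ws ! i) x y" using T(3)[of x y] h by auto
      then show ?thesis using R_lt[OF i(2), of b 1] DN[OF h(1)] by (auto simp: lhs_def rhs_def Z_def)
    next
      case False
      then obtain i where i: "i \<in> P" "R (ws ! i) y x" using T(3)[of y x] h by auto
      then show ?thesis using R_gt[OF i(2), of b 0] DN[OF h(1)] P(1) by (auto simp: lhs_def rhs_def Z_def)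
    qed
    have sign: "A (r (fst_row b), x) < A (r (fst_row b), y)"
      if h: "b \<in> D" "x \<in> T" "y \<in> T" "d * x < d * y" for b x y
    proof (cases up)
      case True
      then obtain i where i: "i \<in> P" "R (ws ! i) x y" using T(3)[of x y] h by (auto simp: d_def)
      then show ?thesis using R_lt[OF i(2), of b 2] DN[OF h(1)] True by (auto simp: lhs_def rhs_def Z_def)
    next
      case False
      then obtain i where i: "i \<in> P" "R (ws ! i) y x" using T(3)[of y x] h by (auto simp: d_def)
      then show ?thesis using R_gt[OF i(2), of b 2] DN[OF h(1)] P(1) False
        by (auto simp: lhs_def rhs_def Z_def)
    qed
    let ?S = "(\<lambda>b. r (fst_row b)) ` D"
    have "inj_on (\<lambda>b. r (fst_row b)) D"
    proof (rule inj_onI)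
      fix b b' assume b: "b \<in> D" "b' \<in> D" "r (fst_row b) = r (fst_row b')"
      have "fst_row b = fst_row b'" using rows(1) DN(1) b by (intro inj_onD[OF inj_r b(3)]) auto
      then show "b = b'" using \<open>0 < n\<close> by (simp add: fst_row_def)
    qed
    then have "card ?S = n" using D(2) by (simp add: card_image)
    moreover have "lex_monotone ?S T A"
    proof (rule lex_monotone_row_major[OF e d])
      fix a a' x y assume *: "a \<in> ?S" "a' \<in> ?S" "x \<in> T" "y \<in> T" "e * a < e * a'"
      then obtain b b' where b: "a = r (fst_row b)" "a' = r (fst_row b')" "b \<in> D" "b' \<in> D" by auto
      then have "fst_row b < fst_row b'" using * r_less_iff rows DN by auto
      then have bb: "b < b'" by (simp add: fst_row_def)
      \<comment> \<open>For \<open>x \<noteq> y\<close> the chain runs from the first row of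
        \<open>b\<close> in column \<open>x\<close> to the last row of \<open>b\<close> in column
        \<open>y\<close>, then up column \<open>y\<close> to the first row of the later block
        \<open>b'\<close>.\<close>
      show "A (a, x) < A (a', y)"
      proof (cases "x = y")
        case True
        then show ?thesis using \<open>fst_row b < fst_row b'\<close> b * T(1) rows DN by (auto intro!: rowI)
      next
        case False
        have "A (r (lst_row b), y) < A (r (fst_row b'), y)"
          using lst_less[OF bb] rows(1)[of b'] DN b * T(1) by (auto intro!: rowI simp: fst_row_def)
        then show ?thesis using interleaved[OF b(3) *(3,4) False] b by simp
      qed
    qed (use sign in auto)
    ultimately show ?thesis using T rows DN
      by (intro exI[of _ ?S] exI[of _ T]) auto
  qed
qed

section \<open>Sufficient size and the explicit bound\<close>

text \<open>The exponent adds \<open>Suc (m * m)\<close> for the pigeonhole over row sets and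
  directions to the size needed for the tree. That there are \<open>m * m\<close> rows follows from
  \<open>m * m < 2 ^ (m * m)\<close>.\<close>

lemma contains_lex_monotone_if_large:
  assumes "0 < n" "n \<le> 2 ^ k" "m = n * (2 * n * 4 ^ k)"
    and "E = Suc (m * m) + (Suc (3 * (2 * n * 4 ^ k)) * (8 * k))\<^sup>2"
    and "2 ^ E \<le> N" "is_array N S1 S2 A"
  shows "contains_lex_monotone n S1 S2 A"
proof -
  let ?Q = "2 ^ ((Suc (3 * (2 * n * 4 ^ k)) * (8 * k))\<^sup>2) :: nat"
  have arr: "finite S1" "finite S2" "card S1 = N" "card S2 = N" "inj_on A (S1 \<times> S2)"
    using assms(6) by (auto simp: is_array_def)
  have m0: "0 < m" using assms(1,3) by simp
  have Q: "2 ^ Suc (m * m) * ?Q \<le> card S2" using assms(4,5) arr by (simp add: power_add)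
  have "m * m < 2 ^ (m * m)" by (rule less_exp)
  also have "\<dots> \<le> 2 ^ E" unfolding assms(4) by (intro power_increasing) auto
  finally have "m * m \<le> card S1" using assms(5) arr by simp
  from monotone_rows[OF arr(1,2,5) m0 this _ Q] obtain e r Y where
    e: "e \<in> {-1, 1}" and Y: "Y \<subseteq> S2" "?Q \<le> card Y" and r: "\<And>i. i < m \<Longrightarrow> r i \<in> S1"
    and mono: "\<And>i j. i < j \<Longrightarrow> j < m \<Longrightarrow> e * r i < e * r j \<and> (\<forall>y\<in>Y. A (r i, y) < A (r j, y))"
    by (metis zero_less_numeral zero_less_power)
  have neq: "A (r i, x) \<noteq> A (r j, y)" if "i < m" "j < m" "x \<in> Y" "y \<in> Y" "x \<noteq> y" for i j x y
    using inj_onD[OF arr(5), of "(r i, x)" "(r j, y)"] r that Y(1) by auto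
  have "\<exists>S\<subseteq>r ` {..<m}. \<exists>T\<subseteq>Y. card S = n \<and> card T = n \<and> lex_monotone S T A"
    unfolding assms(3)
  proof (rule lex_monotone_from_monotone_rows[OF e _ assms(1,2) refl], unfold assms(3)[symmetric])
    show "finite Y" using Y(1) arr(2) finite_subset by blast
  qed (use mono neq Y in auto)
  then obtain S T where "S \<subseteq> r ` {..<m}" "T \<subseteq> Y" "card S = n" "card T = n" "lex_monotone S T A"
    by blast
  moreover from this have "S \<subseteq> S1" "T \<subseteq> S2" using r Y(1) by auto
  ultimately show ?thesis
    unfolding contains_lex_monotone_def using arr(1,2)
    by (intro exI[of _ S] exI[of _ T]) (auto intro: finite_subset)
qed

text \<open>For \<open>n = 1\<close> the logarithm vanishes and the bound is \<open>2 ^ 0\<close>,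
  so this case is treated apart.\<close>

lemma contains_lex_monotone_one:
  assumes "1 \<le> N" "is_array N S1 S2 A"
  shows "contains_lex_monotone 1 S1 S2 A"
proof -
  have "S1 \<noteq> {}" "S2 \<noteq> {}" using assms by (auto simp: is_array_def)
  then obtain x y where xy: "x \<in> S1" "y \<in> S2" by auto
  have "lex_monotone {x} {y} A" by (rule lex_monotone_row_major[of 1 1]) auto
  then show ?thesis unfolding contains_lex_monotone_def using xy
    by (intro exI[of _ "{x}"] exI[of _ "{y}"]) auto
qed

text \<open>With \<open>k\<close> the logarithm rounded up, \<open>2 ^ k \<le> 2 * n\<close>, so the
  number of blocks is at most \<open>8 * n ^ 3\<close> and \<open>m \<le> 8 * n ^ 4\<close>. Hence
  \<open>m * m\<close> is of order \<open>n ^ 8\<close>, and the tree contributes order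
  \<open>n ^ 6\<close> times the squared logarithm.\<close>

lemma exponent_bound:
  fixes n :: nat
  assumes "2 \<le> n"
  obtains k m E where "n \<le> 2 ^ k" "m = n * (2 * n * 4 ^ k)"
    "E = Suc (m * m) + (Suc (3 * (2 * n * 4 ^ k)) * (8 * k))\<^sup>2"
    "real E \<le> 300000 * real n ^ 8 * (log 2 (real n))\<^sup>2"
proof -
  define l where "l = log 2 (real n)"
  define k where "k = nat \<lceil>l\<rceil>"
  define x where "x = real n"
  have x2: "2 \<le> x" using assms by (simp add: x_def)
  have l1: "1 \<le> l" using assms by (simp add: l_def)
  have k_ge: "l \<le> real k" and k_le: "real k \<le> l + 1" using l1 by (simp_all add: k_def)
  have pl: "2 powr l = x" using x2 by (simp add: l_def x_def)
  have "x \<le> 2 powr real k" unfolding pl[symmetric] using k_ge by (intro powr_mono) auto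
  then have "real n \<le> real (2 ^ k)" by (simp add: powr_realpow x_def)
  then have nk: "n \<le> 2 ^ k" by (simp only: of_nat_le_iff)
  have "2 powr real k \<le> 2 powr (l + 1)" using k_le by (intro powr_mono) auto
  then have p2: "2 ^ k \<le> 2 * x" using pl by (simp add: powr_realpow powr_add)
  define q where "q = real (2 * n * 4 ^ k)"
  have "(4::real) ^ k = 2 ^ k * 2 ^ k" by (simp flip: power_mult_distrib)
  also have "\<dots> \<le> (2 * x) * (2 * x)" using p2 x2 by (intro mult_mono) auto
  finally have "q \<le> 2 * x * ((2 * x) * (2 * x))"
    unfolding q_def using x2 by (simp add: x_def mult_left_mono)
  then have q8: "q \<le> 8 * x ^ 3" by (simp add: power3_eq_cube mult_ac)
  have "1 \<le> 2 * n * 4 ^ k" using assms by (simp add: Suc_le_eq)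
  then have "real 1 \<le> q" unfolding q_def of_nat_le_iff .
  then have q1: "1 \<le> q" by simp
  define m where "m = n * (2 * n * 4 ^ k)"
  define E where "E = Suc (m * m) + (Suc (3 * (2 * n * 4 ^ k)) * (8 * k))\<^sup>2"
  have E: "real E = 1 + (x * q)\<^sup>2 + ((1 + 3 * q) * (8 * real k))\<^sup>2"
    by (simp add: E_def m_def q_def x_def power2_eq_square algebra_simps)
  have "x * q \<le> x * (8 * x ^ 3)" using q8 x2 by (intro mult_left_mono) auto
  then have "(x * q)\<^sup>2 \<le> (x * (8 * x ^ 3))\<^sup>2" using q1 x2 by (intro power_mono) auto
  also have "\<dots> = 64 * x ^ 8" by (simp add: eval_nat_numeral)
  finally have e1: "(x * q)\<^sup>2 \<le> 64 * x ^ 8" .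
  \<comment> \<open>Here \<open>1 + 3 * q \<le> 4 * q\<close> since \<open>1 \<le> q\<close>, and
    \<open>k \<le> l + 1 \<le> 2 * l\<close> since \<open>1 \<le> l\<close>.\<close>
  have "(1 + 3 * q) * (8 * real k) \<le> (32 * x ^ 3) * (8 * (2 * l))"
    using q8 q1 k_le l1 x2 by (intro mult_mono) auto
  then have "((1 + 3 * q) * (8 * real k))\<^sup>2 \<le> ((32 * x ^ 3) * (8 * (2 * l)))\<^sup>2"
    using q1 by (intro power_mono) auto
  also have "\<dots> = 262144 * x ^ 6 * l\<^sup>2" by (simp add: eval_nat_numeral)
  also have "\<dots> \<le> 262144 * x ^ 8 * l\<^sup>2"
    using x2 by (intro mult_right_mono mult_left_mono power_increasing) auto
  finally have e2: "((1 + 3 * q) * (8 * real k))\<^sup>2 \<le> 262144 * (x ^ 8 * l\<^sup>2)" by simp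
  have "1 \<le> x ^ 8" using x2 by (intro one_le_power) auto
  moreover have "x ^ 8 * 1 \<le> x ^ 8 * l\<^sup>2"
    using l1 x2 by (intro mult_left_mono one_le_power) auto
  ultimately have "real E \<le> 300000 * (x ^ 8 * l\<^sup>2)" using e1 e2 unfolding E by linarith
  then show thesis using that[OF nk m_def E_def] by (simp add: x_def l_def mult.assoc)
qed

theorem theorem4:
  "\<exists>c::real. c > 0 \<and>
     (\<forall>n::nat. n \<ge> 1 \<longrightarrow>
        real (L2 n) \<le> 2 powr (c * real n ^ 8 * (log 2 (real n))\<^sup>2) \<and>
        (\<forall>N S1 S2 A.
           real N \<ge> 2 powr (c * real n ^ 8 * (log 2 (real n))\<^sup>2) \<longrightarrow>
           is_array N S1 S2 A \<longrightarrow>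
           contains_lex_monotone n S1 S2 A))"
proof (intro exI[of _ "300000::real"] conjI allI impI)
  \<comment> \<open>One natural exponent \<open>E\<close> serves both claims: \<open>2 ^ E\<close>
    is a candidate in the minimum defining \<open>L2 n\<close>, and every \<open>N\<close> above the
    real bound is at least \<open>2 ^ E\<close>.\<close>
  have main: "\<exists>E. real E \<le> 300000 * real n ^ 8 * (log 2 (real n))\<^sup>2 \<and>
    (\<forall>N S1 S2 A. 2 ^ E \<le> N \<longrightarrow> is_array N S1 S2 A \<longrightarrow> contains_lex_monotone n S1 S2 A)"
    if "n \<ge> 1" for n :: nat
  proof (cases "n = 1")
    case True
    then show ?thesis using contains_lex_monotone_one by (intro exI[of _ 0]) auto
  next
    case False
    then have "2 \<le> n" using that by simp
    then obtain k m E where E: "n \<le> 2 ^ k" "m = n * (2 * n * 4 ^ k)"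
      "E = Suc (m * m) + (Suc (3 * (2 * n * 4 ^ k)) * (8 * k))\<^sup>2"
      "real E \<le> 300000 * real n ^ 8 * (log 2 (real n))\<^sup>2" by (rule exponent_bound)
    have "0 < n" using that by simp
    with contains_lex_monotone_if_large[OF _ E(1-3)] E(4) show ?thesis
      by (intro exI[of _ E] conjI allI impI)
  qed
  fix n :: nat assume "n \<ge> 1"
  then obtain E where E: "real E \<le> 300000 * real n ^ 8 * (log 2 (real n))\<^sup>2"
    "\<And>N S1 S2 A. 2 ^ E \<le> N \<Longrightarrow> is_array N S1 S2 A \<Longrightarrow> contains_lex_monotone n S1 S2 A"
    using main by meson
  have pow: "real (2 ^ E) \<le> 2 powr (300000 * real n ^ 8 * (log 2 (real n))\<^sup>2)"
    using E(1) by (simp flip: powr_realpow)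
  have "L2 n \<le> 2 ^ E" unfolding L2_def using E(2) by (intro Least_le) auto
  then show "real (L2 n) \<le> 2 powr (300000 * real n ^ 8 * (log 2 (real n))\<^sup>2)"
    using pow by (meson of_nat_le_iff order_trans)
  fix N S1 S2 A
  assume "2 powr (300000 * real n ^ 8 * (log 2 (real n))\<^sup>2) \<le> real N" "is_array N S1 S2 A"
  then show "contains_lex_monotone n S1 S2 A"
    using pow E(2)[of N] by (meson of_nat_le_iff order_trans)
qed simp

end
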